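(* Let $\Lambda=\{\lambda_1,\ldots,\lambda_n\}$ be the spectrum of an $n\times n$ real matrix $A$. Then $\Lambda\cup-\Lambda$ is $\mathcal{H}$-realizable.
   Context: Spectra are lists of eigenvalues counted with algebraic multiplicity; unions of lists are taken with multiplicity; $-\Lambda=\{-\lambda_1,\ldots,-\lambda_n\}$. Let $J=\begin{pmatrix}0&I_n\\-I_n&0\end{pmatrix}$. A real $2n\times 2n$ matrix $H$ is Hamiltonian if $H^TJ+JH=0$. A list of $2n$ complex numbers is $\mathcal{H}$-realizable if it is the spectrum of some $2n\times 2n$ real Hamiltonian matrix. *)

theory Defs
  imports "Jordan_Normal_Form.Char_Poly"
begin

(* The eigenvalues in \<complex>, with algebraic multiplicity (order as a root of the
   characteristic polynomial). Unordered lists are multisets, so that union of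
   lists is +. The library constant spectrum is only the set of eigenvalues. *)
definition spectrum_mset :: "real mat \<Rightarrow> complex multiset" where
  "spectrum_mset A = proots (char_poly (map_mat complex_of_real A))"

definition J_mat :: "nat \<Rightarrow> real mat" where
  "J_mat n = four_block_mat (0\<^sub>m n n) (1\<^sub>m n) (- 1\<^sub>m n) (0\<^sub>m n n)"

definition hamiltonian :: "nat \<Rightarrow> real mat \<Rightarrow> bool" where
  "hamiltonian n H \<longleftrightarrow>
     H \<in> carrier_mat (2 * n) (2 * n) \<and>
     transpose_mat H * J_mat n + J_mat n * H = 0\<^sub>m (2 * n) (2 * n)"

definition H_realizable :: "nat \<Rightarrow> complex multiset \<Rightarrow> bool" where
  "H_realizable n L \<longleftrightarrow>
     size L = 2 * n \<and> (\<exists>H. hamiltonian n H \<and> spectrum_mset H = L)"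

end

theory Submission
  imports Defs
begin

(* The block diagonal matrix diag(A, -A^T) is Hamiltonian, and its characteristic polynomial is
   p(x) q(x), where p is the characteristic polynomial of A and q(x) = (-1)^n p(-x) is that of
   -A^T. The roots of q are the negated roots of p. *)

text \<open>Subtracting the blocks from \<open>x * I\<close> keeps the off-diagonal blocks zero, so
  the determinant splits as for any block triangular matrix.\<close>

lemma char_poly_four_block_diag:
  fixes A D :: "'a :: idom mat"
  assumes A: "A \<in> carrier_mat n n" and D: "D \<in> carrier_mat m m"
  shows "char_poly (four_block_mat A (0\<^sub>m n m) (0\<^sub>m m n) D) = char_poly A * char_poly D"
proof -
  have "char_poly_matrix (four_block_mat A (0\<^sub>m n m) (0\<^sub>m m n) D) =
      four_block_mat (char_poly_matrix A) (0\<^sub>m n m) (0\<^sub>m m n) (char_poly_matrix D)"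
    unfolding char_poly_matrix_def
    by (rule eq_matI) (use A D in \<open>auto simp: one_poly_def\<close>)
  then show ?thesis
    unfolding char_poly_def
    by (simp add: det_four_block_mat_lower_left_zero[OF _ _ refl] A D)
qed

text \<open>The identity \<open>xI + A = -((-x)I - A)\<close> is the reason: the outer sign leaves
  the determinant as \<open>(-1) ^ n\<close>, and the substitution of \<open>-x\<close> for
  \<open>x\<close> is a ring homomorphism, so it commutes with \<open>det\<close>.\<close>

lemma char_poly_uminus:
  fixes A :: "'a :: idom mat"
  assumes A: "A \<in> carrier_mat n n"
  shows "char_poly (- A) = (-1) ^ n * pcompose (char_poly A) [:0, -1:]"
proof -
  have "char_poly_matrix (- A) =
      (-1) \<cdot>\<^sub>m map_mat (\<lambda>p. pcompose p [:0, -1:]) (char_poly_matrix A)"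
    unfolding char_poly_matrix_def
    by (rule eq_matI) (use A in \<open>auto simp: pcompose_pCons pcompose_add\<close>)
  moreover have "dim_col (char_poly_matrix A) = n"
    using char_poly_matrix_closed[OF A] by auto
  ultimately show ?thesis
    unfolding char_poly_def by (simp add: comm_ring_hom.hom_det[OF pcompose_hom.comm_ring_hom_axioms])
qed

lemma proots_prod_list_linear:
  "proots (\<Prod>a\<leftarrow>as. [:- a, 1:]) = mset (as :: 'a :: idom list)"
proof (induction as)
  case (Cons a as)
  have "(\<Prod>a\<leftarrow>as. [:- a, 1:]) \<noteq> 0"
    by (auto simp: prod_list_zero_iff)
  with Cons show ?case
    by (simp add: proots_mult del: mult_pCons_left)
qed simp

text \<open>Over the complex numbers \<open>p\<close> splits into linear factors, and substituting
  \<open>-x\<close> turns \<open>x - a\<close> into \<open>-(x + a)\<close>. Working with the list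
  of factors keeps track of multiplicities.\<close>

lemma proots_pcompose_neg:
  fixes p :: "complex poly"
  assumes "p \<noteq> 0"
  shows "proots (pcompose p [:0, -1:]) = image_mset uminus (proots p)"
proof -
  obtain as where as: "Polynomial.smult (lead_coeff p) (\<Prod>a\<leftarrow>as. [:- a, 1:]) = p"
    using fundamental_theorem_algebra_factorized by blast
  have comp: "pcompose (\<Prod>a\<leftarrow>as. [:- a, 1:]) [:0, -1:] =
      (-1) ^ length as * (\<Prod>a\<leftarrow>map uminus as. [:- a, 1:])" for as :: "complex list"
  proof (induction as)
    case (Cons a as)
    have "pcompose [:- a, 1:] [:0, -1:] = - [:- (- a), 1:]"
      by (simp add: pcompose_pCons)
    then show ?case
      by (simp only: list.map prod_list.Cons pcompose_mult Cons.IH length_Cons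
          power_Suc mult_minus_left mult_minus_right mult_1_left mult.left_commute)
  qed simp
  \<comment> \<open>The sign collected from the linear factors is a nonzero constant and does not
    affect roots.\<close>
  have neg_one: "proots ((-1) ^ k * q) = proots q" for k and q :: "complex poly"
    by (cases "even k") auto
  have lc: "lead_coeff p \<noteq> 0"
    using assms by simp
  have "proots (pcompose p [:0, -1:]) = mset (map uminus as)"
    by (subst as[symmetric]) (simp only: pcompose_smult comp proots_smult[OF lc] neg_one proots_prod_list_linear)
  moreover have "proots p = mset as"
    by (subst as[symmetric]) (simp only: proots_smult[OF lc] proots_prod_list_linear)
  ultimately show ?thesis by simp
qed

text \<open>Supplies the size condition of \<open>H_realizable\<close>: a complex polynomial has as
  many roots, with multiplicity, as its degree.\<close>

lemma size_spectrum_mset: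
  assumes "A \<in> carrier_mat n n"
  shows "size (spectrum_mset A) = n"
  unfolding spectrum_mset_def size_proots_complex
  using degree_monic_char_poly[of "map_mat complex_of_real A" n] assms by auto

lemma spectrum_mset_four_block_diag:
  assumes A: "A \<in> carrier_mat n n" and D: "D \<in> carrier_mat m m"
  shows "spectrum_mset (four_block_mat A (0\<^sub>m n m) (0\<^sub>m m n) D) = spectrum_mset A + spectrum_mset D"
proof -
  let ?c = "map_mat complex_of_real"
  \<comment> \<open>Characteristic polynomials are monic, hence nonzero, as
    \<open>proots_mult\<close> requires.\<close>
  have nz: "char_poly (?c A) \<noteq> 0" "char_poly (?c D) \<noteq> 0"
    using degree_monic_char_poly[of "?c A" n] degree_monic_char_poly[of "?c D" m] A D by auto
  have "?c (four_block_mat A (0\<^sub>m n m) (0\<^sub>m m n) D) = four_block_mat (?c A) (0\<^sub>m n m) (0\<^sub>m m n) (?c D)"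
    by (rule eq_matI) (use A D in auto)
  then show ?thesis
    unfolding spectrum_mset_def
    using nz A D by (simp add: char_poly_four_block_diag proots_mult)
qed

text \<open>Transposition preserves the characteristic polynomial, so only the negation acts on the
  spectrum.\<close>

lemma spectrum_mset_uminus_transpose:
  assumes A: "A \<in> carrier_mat n n"
  shows "spectrum_mset (- transpose_mat A) = image_mset uminus (spectrum_mset A)"
proof -
  let ?B = "map_mat complex_of_real A"
  have B: "?B \<in> carrier_mat n n" and BT: "transpose_mat ?B \<in> carrier_mat n n"
    using A by auto
  have nz: "char_poly ?B \<noteq> 0"
    using degree_monic_char_poly[OF B] by auto
  have "map_mat complex_of_real (- transpose_mat A) = - transpose_mat ?B"
    by (rule eq_matI) auto
  then have "spectrum_mset (- transpose_mat A) =
      proots ((-1) ^ n * pcompose (char_poly ?B) [:0, -1:])"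
    unfolding spectrum_mset_def using char_poly_uminus[OF BT] char_poly_transpose_mat[OF B] by simp
  also have "\<dots> = proots (pcompose (char_poly ?B) [:0, -1:])"
    by (cases "even n") auto
  finally show ?thesis
    unfolding spectrum_mset_def proots_pcompose_neg[OF nz] .
qed

text \<open>Multiplying a block diagonal matrix by \<open>J_mat n\<close> gives an off-diagonal one;
  the lower block \<open>- transpose_mat A\<close> is chosen so that the two products
  cancel.\<close>

lemma hamiltonian_four_block_diag:
  assumes A: "A \<in> carrier_mat n n"
  shows "hamiltonian n (four_block_mat A (0\<^sub>m n n) (0\<^sub>m n n) (- transpose_mat A))"
proof -
  let ?Z = "0\<^sub>m n n :: real mat" and ?I = "1\<^sub>m n :: real mat"
  let ?H = "four_block_mat A ?Z ?Z (- transpose_mat A)"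
  have T: "transpose_mat A \<in> carrier_mat n n" "- transpose_mat A \<in> carrier_mat n n" "- A \<in> carrier_mat n n"
    and I: "- ?I \<in> carrier_mat n n" and Z: "- ?Z = ?Z"
    using A by auto
  have "transpose_mat ?H = four_block_mat (transpose_mat A) ?Z ?Z (- A)"
    by (rule eq_matI) (use A in auto)
  then have "transpose_mat ?H * J_mat n = four_block_mat ?Z (transpose_mat A) A ?Z"
    unfolding J_mat_def using A T I Z
    \<comment> \<open>The block dimensions occur only in the premises of
      \<open>mult_four_block_mat\<close>, not in its equation, so they are set to \<open>n\<close>
      explicitly.\<close>
    by (simp add: mult_four_block_mat[of _ n n _ n _ n _ _ n _ n])
  moreover have "J_mat n * ?H = four_block_mat ?Z (- transpose_mat A) (- A) ?Z"
    unfolding J_mat_def using A T I Z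
    by (simp add: mult_four_block_mat[of _ n n _ n _ n _ _ n _ n])
  ultimately have "transpose_mat ?H * J_mat n + J_mat n * ?H = 0\<^sub>m (2 * n) (2 * n)"
    by (intro eq_matI) (use A in auto)
  moreover have "?H \<in> carrier_mat (2 * n) (2 * n)"
    using four_block_carrier_mat[OF A T(2)] by (simp add: mult_2)
  ultimately show ?thesis
    by (simp add: hamiltonian_def)
qed

theorem corollary6:
  fixes n :: nat and A :: "real mat" and \<Lambda> :: "complex multiset"
  assumes "A \<in> carrier_mat n n"
    and "\<Lambda> = spectrum_mset A"
  shows "H_realizable n (\<Lambda> + image_mset uminus \<Lambda>)"
proof -
  have "- transpose_mat A \<in> carrier_mat n n"
    using assms(1) by auto
  then show ?thesis
    unfolding H_realizable_def assms(2)
    using hamiltonian_four_block_diag[OF assms(1)] spectrum_mset_four_block_diag[OF assms(1)]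
      spectrum_mset_uminus_transpose[OF assms(1)] size_spectrum_mset[OF assms(1)]
    by force
qed

end
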